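(* Let $X=(X_1,X_2)$ be a random vector with values in $[0,\infty)^2$. If the distribution of $X$ is BVGGC in the strong sense, then $X\sim$ BVGGC-L, i.e. the Laplace transform $(s_1,s_2)\mapsto E\big[e^{-s_1X_1-s_2X_2}\big]$, $s_1,s_2>0$, is BVHCM.
   Context: A distribution on $[0,\infty)^2$ is BVGGC in the strong sense if it is the limit in distribution of a sequence of random vectors $Z_n=\big(\sum_{j=1}^n c_{1,j}Y_j,\ \sum_{j=1}^n c_{2,j}Y_j\big)$, where the $Y_j$ are independent Gamma random variables with unit scale (and arbitrary shape parameters $\gamma_j>0$), and $c_{1,j},c_{2,j}\ge 0$ are constants; the constants and shape parameters are allowed to depend on $n$. A nonnegative function $f$ on $(0,\infty)^2$ is BVHCM (bivariate hyperbolically completely monotone) if for all fixed $u_1,u_2>0$ the product $f(u_1v_1,u_2v_2)f(u_1/v_1,u_2/v_2)$ is completely monotone as a function of $w_1=v_1+1/v_1$, $w_2=v_2+1/v_2$, $w_3=v_1/v_2+v_2/v_1$. This means: for all fixed $u_1,u_2>0$ there is a nonnegative Borel measure $\nu$ on $[0,\infty)^3$ (depending on $u_1,u_2$) such that for all $v_1,v_2>0$ $$f(u_1v_1,u_2v_2)f(u_1/v_1,u_2/v_2)=\int e^{-\lambda_1w_1-\lambda_2w_2-\lambda_3w_3}\,d\nu(\lambda_1,\lambda_2,\lambda_3).$$ BVGGC-L is the class of random vectors (distributions) on $[0,\infty)^2$ whose Laplace transform is BVHCM. *)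

theory Defs
  imports "HOL-Probability.Probability"
begin

definition gamma_density :: "real \<Rightarrow> real \<Rightarrow> real" where
  "gamma_density a x = (if x \<le> 0 then 0 else x powr (a - 1) * exp (- x) / Gamma a)"

definition quadrant_distribution :: "(real \<times> real) measure \<Rightarrow> bool" where
  "quadrant_distribution \<mu> \<longleftrightarrow>
     prob_space \<mu> \<and> sets \<mu> = sets borel \<and> (AE x in \<mu>. 0 \<le> fst x \<and> 0 \<le> snd x)"

text \<open>
  The library's weak convergence is formulated with distribution functions on the real line;
  this is the usual definition for Borel probability measures on a metric space.
\<close>
definition converges_in_distribution ::
    "(nat \<Rightarrow> 'a::metric_space measure) \<Rightarrow> 'a measure \<Rightarrow> bool" where
  "converges_in_distribution \<mu>s \<mu> \<longleftrightarrow>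
     (\<forall>f :: 'a \<Rightarrow> real. continuous_on UNIV f \<longrightarrow> bounded (range f) \<longrightarrow>
        (\<lambda>n. \<integral>x. f x \<partial>\<mu>s n) \<longlonglongrightarrow> (\<integral>x. f x \<partial>\<mu>))"

text \<open>
  The law of a vector of two nonnegative linear combinations of the same \<open>n\<close> independent
  unit-scale Gamma variables. A definition cannot quantify over the type of the underlying
  sample space; sample spaces over \<open>nat \<Rightarrow> real\<close> realise all such laws (take the product of
  the \<open>n\<close> Gamma distributions).
\<close>
definition gamma_combination_law :: "nat \<Rightarrow> (real \<times> real) measure \<Rightarrow> bool" where
  "gamma_combination_law n \<mu> \<longleftrightarrow>
     (\<exists>(\<Omega> :: (nat \<Rightarrow> real) measure) (Y :: nat \<Rightarrow> (nat \<Rightarrow> real) \<Rightarrow> real)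
        (\<gamma> :: nat \<Rightarrow> real) (c1 :: nat \<Rightarrow> real) (c2 :: nat \<Rightarrow> real).
        prob_space \<Omega> \<and>
        prob_space.indep_vars \<Omega> (\<lambda>_. borel) Y {1..n} \<and>
        (\<forall>j\<in>{1..n}. 0 < \<gamma> j \<and> 0 \<le> c1 j \<and> 0 \<le> c2 j \<and>
           distributed \<Omega> lborel (Y j) (\<lambda>x. ennreal (gamma_density (\<gamma> j) x))) \<and>
        \<mu> = distr \<Omega> borel (\<lambda>\<omega>. (\<Sum>j=1..n. c1 j * Y j \<omega>, \<Sum>j=1..n. c2 j * Y j \<omega>)))"

definition BVGGC_strong :: "(real \<times> real) measure \<Rightarrow> bool" where
  "BVGGC_strong \<mu> \<longleftrightarrow>
     quadrant_distribution \<mu> \<and>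
     (\<exists>\<mu>s. (\<forall>n. gamma_combination_law n (\<mu>s n)) \<and> converges_in_distribution \<mu>s \<mu>)"

text \<open>
  The representing measure need not be finite. The integral is the extended nonnegative one,
  so the equation forces it to be finite.
\<close>
definition BVHCM :: "(real \<Rightarrow> real \<Rightarrow> real) \<Rightarrow> bool" where
  "BVHCM f \<longleftrightarrow>
     (\<forall>x>0. \<forall>y>0. 0 \<le> f x y) \<and>
     (\<forall>u1>0. \<forall>u2>0. \<exists>\<nu> :: (real \<times> real \<times> real) measure.
        sets \<nu> = sets borel \<and>
        (AE (l1, l2, l3) in \<nu>. 0 \<le> l1 \<and> 0 \<le> l2 \<and> 0 \<le> l3) \<and>
        (\<forall>v1>0. \<forall>v2>0.
           ennreal (f (u1 * v1) (u2 * v2) * f (u1 / v1) (u2 / v2)) =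
           (\<integral>\<^sup>+ (l1, l2, l3). ennreal (exp (- l1 * (v1 + 1 / v1) - l2 * (v2 + 1 / v2)
                                          - l3 * (v1 / v2 + v2 / v1))) \<partial>\<nu>)))"

definition laplace_transform :: "(real \<times> real) measure \<Rightarrow> real \<Rightarrow> real \<Rightarrow> real" where
  "laplace_transform \<mu> s1 s2 = (\<integral>x. exp (- s1 * fst x - s2 * snd x) \<partial>\<mu>)"

definition BVGGC_L :: "(real \<times> real) measure \<Rightarrow> bool" where
  "BVGGC_L \<mu> \<longleftrightarrow> quadrant_distribution \<mu> \<and> BVHCM (laplace_transform \<mu>)"

end

theory Submission
  imports Defs
begin

text \<open>
  For a single Gamma factor put \<open>a = c\<^sub>1 u\<^sub>1\<close>, \<open>b = c\<^sub>2 u\<^sub>2\<close>. Then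
  \<open>(1 + a v\<^sub>1 + b v\<^sub>2) (1 + a / v\<^sub>1 + b / v\<^sub>2) = (1 + a\<^sup>2 + b\<^sup>2) + a w\<^sub>1 + b w\<^sub>2 + a b w\<^sub>3\<close>,
  so the product of Laplace transforms is, up to the constant \<open>\<Prod> (1 + a\<^sup>2 + b\<^sup>2)\<close> to the powers
  \<open>- \<gamma>\<^sub>j\<close>, the Laplace transform in \<open>w\<close> of three nonnegative combinations of the same Gamma
  variables. Passing to the limit requires only vague compactness of probability measures on
  \<open>[0,\<infinity>)\<^sup>3\<close>, because \<open>exp (- \<lambda> \<bullet> w)\<close> vanishes at infinity when all \<open>w\<^sub>i > 0\<close>. It is
  deduced from Helly's theorem on the line: after \<open>\<lambda> \<mapsto> 1 - exp (- \<lambda>)\<close>, the binary digits of the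
  three coordinates are interleaved into one ternary number, a measurable map from the cube to
  the Cantor set, which Schoenberg's space-filling curve inverts continuously.
\<close>

subsection \<open>The Laplace transform of the Gamma density\<close>

text \<open>The substitution \<open>t = (1 + s) x\<close> turns Euler's integral for
  \<open>Gamma a\<close> into the integral of the tilted density. Working with extended nonnegative
  integrals avoids any integrability argument.\<close>

lemma gamma_density_laplace:
  assumes a: "0 < a" and s: "0 \<le> s"
  shows "(\<integral>\<^sup>+x. ennreal (gamma_density a x) * ennreal (exp (- s * x)) \<partial>lborel)
    = ennreal ((1 + s) powr - a)"
proof -
  let ?c = "1 + s"
  have c: "?c > 0" using s by simp
  have G: "Gamma a > 0" using a by (rule Gamma_real_pos)
  let ?g = "\<lambda>t::real. ennreal (indicator {0..} t * t powr (a - 1) / exp t)"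
  have "ennreal (Gamma a) = nn_integral lborel ?g"
    using a by (rule Gamma_conv_nn_integral_real)
  also have "\<dots> = ennreal ?c * (\<integral>\<^sup>+t. ?g (?c * t) \<partial>lborel)"
    using nn_integral_real_affine[of ?g ?c 0] c by simp
  also have "(\<integral>\<^sup>+t. ?g (?c * t) \<partial>lborel) =
      (\<integral>\<^sup>+t. ennreal (?c powr (a - 1) * Gamma a) *
        (ennreal (gamma_density a t) * ennreal (exp (- s * t))) \<partial>lborel)"
  proof (rule nn_integral_cong)
    fix t :: real
    show "?g (?c * t) = ennreal (?c powr (a - 1) * Gamma a) *
        (ennreal (gamma_density a t) * ennreal (exp (- s * t)))"
    proof (cases "t > 0")
      case True
      have "exp (- t) * exp (- s * t) = inverse (exp (?c * t))"
        unfolding exp_add[symmetric] exp_minus[symmetric] by (simp add: algebra_simps)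
      moreover have "(?c * t) powr (a - 1) = ?c powr (a - 1) * t powr (a - 1)"
        using c True by (simp add: powr_mult)
      moreover have "?c * t \<ge> 0" using c True by simp
      ultimately show ?thesis
        using True G c
        by (simp add: gamma_density_def ennreal_mult'[symmetric] divide_inverse mult.assoc
            flip: ennreal_mult') (simp add: field_simps)
    next
      case False
      show ?thesis
      proof (cases "t = 0")
        case True
        \<comment> \<open>The indicator in Euler's integral includes 0, but the integrand still
          vanishes there because \<open>0 powr (a - 1) = 0\<close> by convention, also for
          \<open>a = 1\<close>.\<close>
        then show ?thesis by (simp add: gamma_density_def)
      next
        case nz: False
        have "?c * t < 0" using c False nz by (simp add: mult_pos_neg)
        then show ?thesis using False by (simp add: gamma_density_def)
      qed
    qed
  qed
  also have "\<dots> = ennreal (?c powr (a - 1) * Gamma a) *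
      (\<integral>\<^sup>+x. ennreal (gamma_density a x) * ennreal (exp (- s * x)) \<partial>lborel)"
    by (rule nn_integral_cmult) (unfold gamma_density_def, measurable)
  finally have "ennreal (Gamma a) = ennreal (?c * (?c powr (a - 1) * Gamma a)) *
      (\<integral>\<^sup>+x. ennreal (gamma_density a x) * ennreal (exp (- s * x)) \<partial>lborel)" (is "_ = _ * ?I")
    using c by (simp only: ennreal_mult' mult.assoc less_imp_le)
  moreover have "?c * (?c powr (a - 1) * Gamma a) = Gamma a * ?c powr a"
    using c by (simp add: powr_diff)
  ultimately have eq: "ennreal (Gamma a) = ennreal (Gamma a * ?c powr a) * ?I"
    by simp
  \<comment> \<open>The finite positive factor is cancelled inside \<open>ennreal\<close> by
    multiplying with its real reciprocal.\<close>
  have "ennreal (?c powr - a) = ennreal (?c powr - a / Gamma a) * ennreal (Gamma a)"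
    using c G by (simp flip: ennreal_mult')
  also have "\<dots> = ennreal (?c powr - a / Gamma a * (Gamma a * ?c powr a)) * ?I"
    unfolding eq using c G by (subst ennreal_mult') (auto simp: mult.assoc)
  also have "?c powr - a / Gamma a * (Gamma a * ?c powr a) = 1"
    using c G by (simp add: powr_minus field_simps)
  finally show ?thesis by simp
qed

subsection \<open>Schoenberg's space-filling curve\<close>

text \<open>Digits are counted from 0, so digit \<open>k\<close> has weight
  \<open>1 / 2 ^ Suc k\<close>. The floor formula selects the terminating expansion of a dyadic
  rational and makes measurability immediate.\<close>

definition dyadic_digit :: "nat \<Rightarrow> real \<Rightarrow> real" where
  "dyadic_digit k x = of_int (\<lfloor>2 ^ Suc k * x\<rfloor> - 2 * \<lfloor>2 ^ k * x\<rfloor>)"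

lemma dyadic_digit_01: "dyadic_digit k x \<in> {0, 1}"
proof -
  have "\<lfloor>2 * y\<rfloor> - 2 * \<lfloor>y\<rfloor> \<in> {0, 1}" for y :: real
    by (cases "frac y < 1/2") (auto simp: frac_def; linarith)+
  from this[of "2 ^ k * x"] show ?thesis
    by (auto simp: dyadic_digit_def mult.assoc)
qed

lemma dyadic_digit_measurable [measurable]: "dyadic_digit k \<in> borel_measurable borel"
  unfolding dyadic_digit_def by measurable

text \<open>The partial sums telescope to \<lfloor>2^n x\<rfloor> / 2^n, which is within 2^(-n) of
  x. The range condition makes the initial floor \<lfloor>x\<rfloor> vanish.\<close>

lemma dyadic_expansion:
  assumes "0 \<le> x" "x < 1"
  shows "(\<lambda>k. dyadic_digit k x / 2 ^ Suc k) sums x"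
proof -
  have sum: "(\<Sum>k<n. dyadic_digit k x / 2 ^ Suc k) = of_int \<lfloor>2 ^ n * x\<rfloor> / 2 ^ n" for n
  proof (induction n)
    case 0
    then show ?case using assms by (simp add: floor_eq_iff)
  next
    case (Suc n)
    then show ?case by (simp add: dyadic_digit_def field_simps)
  qed
  have "(\<lambda>n. of_int \<lfloor>2 ^ n * x\<rfloor> / 2 ^ n) \<longlonglongrightarrow> x"
  proof (rule tendsto_sandwich)
    show "\<forall>\<^sub>F n in sequentially. x - (1/2) ^ n \<le> of_int \<lfloor>2 ^ n * x\<rfloor> / 2 ^ n"
    proof (rule always_eventually, rule allI)
      fix n
      have "2 ^ n * x - 1 \<le> of_int \<lfloor>2 ^ n * x\<rfloor>" by linarith
      then have "(2 ^ n * x - 1) / 2 ^ n \<le> of_int \<lfloor>2 ^ n * x\<rfloor> / 2 ^ n"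
        by (rule divide_right_mono) simp
      then show "x - (1/2) ^ n \<le> of_int \<lfloor>2 ^ n * x\<rfloor> / 2 ^ n"
        by (simp add: diff_divide_distrib power_divide)
    qed
    show "\<forall>\<^sub>F n in sequentially. of_int \<lfloor>2 ^ n * x\<rfloor> / 2 ^ n \<le> x"
    proof (rule always_eventually, rule allI)
      fix n
      have "of_int \<lfloor>2 ^ n * x\<rfloor> \<le> 2 ^ n * x" by linarith
      then show "of_int \<lfloor>2 ^ n * x\<rfloor> / 2 ^ n \<le> x"
        by (simp add: field_simps)
    qed
    show "(\<lambda>n. x - (1/2) ^ n) \<longlonglongrightarrow> x"
      by (rule tendsto_eq_intros refl LIMSEQ_power_zero)+ auto
  qed auto
  then show ?thesis unfolding sums_def sum .
qed

text \<open>For a 0-1 sequence \<open>b\<close> this is the point of the Cantor set with ternary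
  digits \<open>2 * b k\<close>.\<close>

definition cantor_code :: "(nat \<Rightarrow> real) \<Rightarrow> real" where
  "cantor_code b = (\<Sum>k. 2 * b k / 3 ^ Suc k)"

lemma cantor_code_sums_bound: "(\<lambda>k. 2 / 3 ^ Suc k) sums (1::real)"
  using sums_mult[OF geometric_sums[of "1/3::real"], of "2/3"]
  by (simp add: power_divide)

lemma cantor_code_summable:
  assumes "\<And>k. b k \<in> {0, 1}"
  shows "summable (\<lambda>k. 2 * b k / 3 ^ Suc k :: real)"
proof (rule summable_comparison_test'[OF sums_summable[OF cantor_code_sums_bound]])
  fix n show "norm (2 * b n / 3 ^ Suc n) \<le> 2 / 3 ^ Suc n"
    using assms[of n] by auto
qed

lemma cantor_code_bounds:
  assumes "\<And>k. b k \<in> {0, 1}"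
  shows "0 \<le> cantor_code b" "cantor_code b \<le> 1"
proof -
  have le: "0 \<le> b k" "b k \<le> 1" for k using assms[of k] by auto
  show "0 \<le> cantor_code b"
    unfolding cantor_code_def by (rule suminf_nonneg[OF cantor_code_summable[OF assms]]) (simp add: le)
  have "cantor_code b \<le> (\<Sum>k. 2 / 3 ^ Suc k)"
    unfolding cantor_code_def
    by (rule suminf_le[OF _ cantor_code_summable[OF assms] sums_summable[OF cantor_code_sums_bound]])
      (simp add: divide_right_mono le)
  then show "cantor_code b \<le> 1"
    using cantor_code_sums_bound by (simp add: sums_iff)
qed

text \<open>Self-similarity of the Cantor set: multiplication by 3 moves the first ternary digit in
  front of the point and shifts the others.\<close>

lemma cantor_code_step:
  assumes "\<And>k. b k \<in> {0, 1}"
  shows "3 * cantor_code b = 2 * b 0 + cantor_code (\<lambda>k. b (Suc k))"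
proof -
  have "(\<Sum>k. 2 * b (Suc k) / 3 ^ Suc (Suc k)) = cantor_code b - 2 * b 0 / 3"
    using suminf_split_head[OF cantor_code_summable[OF assms]] by (simp add: cantor_code_def)
  moreover have "(\<Sum>k. 2 * b (Suc k) / 3 ^ Suc (Suc k)) = cantor_code (\<lambda>k. b (Suc k)) / 3"
    using suminf_divide[OF cantor_code_summable[of "\<lambda>k. b (Suc k)"], of 3] assms
    by (simp add: cantor_code_def mult_ac)
  ultimately show ?thesis by simp
qed

text \<open>
  The wave is \<open>0\<close> on \<open>[0, 1/3]\<close>, \<open>1\<close> on \<open>[2/3, 1]\<close> and has period \<open>2\<close>, so at \<open>3\<^sup>m t\<close> it reads
  off the \<open>m\<close>-th digit of a point \<open>t\<close> of the Cantor set.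
\<close>
definition schoenberg_wave :: "real \<Rightarrow> real" where
  "schoenberg_wave t = max 0 (min 1 (1 / 2 - cos (pi * t)))"

lemma schoenberg_wave_bounds: "0 \<le> schoenberg_wave t" "schoenberg_wave t \<le> 1"
  by (auto simp: schoenberg_wave_def)

lemma schoenberg_wave_periodic: "schoenberg_wave (2 * of_int n + t) = schoenberg_wave t"
proof -
  have "cos (pi * (2 * of_int n + t)) = cos (pi * t + 2 * pi * of_int n)"
    by (simp add: algebra_simps)
  also have "\<dots> = cos (pi * t)"
    by (simp add: cos_add sin_int_2pin cos_int_2pin)
  finally show ?thesis by (simp add: schoenberg_wave_def)
qed

lemma schoenberg_wave_eq_0:
  assumes "0 \<le> t" "t \<le> 1 / 3"
  shows "schoenberg_wave t = 0"
proof -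
  have "cos (pi / 3) \<le> cos (pi * t)"
    by (rule cos_monotone_0_pi_le) (use assms pi_gt_zero in \<open>auto simp: field_simps\<close>)
  then show ?thesis by (simp add: schoenberg_wave_def cos_60)
qed

lemma schoenberg_wave_eq_1:
  assumes "2 / 3 \<le> t" "t \<le> 1"
  shows "schoenberg_wave t = 1"
proof -
  have "cos (pi * t) \<le> cos (2 / 3 * pi)"
    by (rule cos_monotone_0_pi_le) (use assms pi_gt_zero in \<open>auto simp: field_simps\<close>)
  moreover have "cos (2 / 3 * pi) = - (1 / 2)"
    using cos_120 by (simp add: mult.commute)
  ultimately show ?thesis by (simp add: schoenberg_wave_def)
qed

text \<open>Induction on \<open>m\<close>. For \<open>m = 0\<close> the first digit decides whether
  the code lies in [0, 1/3] or in [2/3, 1]. In the step, one factor 3 shifts the digits, and the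
  digit moved out contributes \<open>2 * 3 ^ m * b 0\<close>, an even integer and hence a multiple
  of the period.\<close>

lemma schoenberg_wave_cantor_code:
  assumes "\<And>k. b k \<in> {0, 1}"
  shows "schoenberg_wave (3 ^ m * cantor_code b) = b m"
  using assms
proof (induction m arbitrary: b)
  case 0
  have "cantor_code b = 2 * b 0 / 3 + cantor_code (\<lambda>k. b (Suc k)) / 3"
    using cantor_code_step[of b] 0 by simp
  moreover note cantor_code_bounds[of "\<lambda>k. b (Suc k)", OF 0]
  ultimately show ?case
    using 0[of 0] by (auto intro!: schoenberg_wave_eq_0 schoenberg_wave_eq_1)
next
  case (Suc m)
  have "\<exists>n::int. 3 ^ m * b 0 = of_int n"
    using Suc.prems[of 0] by (auto intro: exI[of _ 0] exI[of _ "3 ^ m"])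
  then obtain n :: int where n: "3 ^ m * b 0 = of_int n" ..
  have "3 ^ Suc m * cantor_code b = 3 ^ m * (3 * cantor_code b)" by simp
  also have "\<dots> = 2 * of_int n + 3 ^ m * cantor_code (\<lambda>k. b (Suc k))"
    unfolding cantor_code_step[OF Suc.prems] n[symmetric] by (simp add: algebra_simps)
  finally show ?case
    using Suc.IH[of "\<lambda>k. b (Suc k)"] Suc.prems by (simp add: schoenberg_wave_periodic)
qed

text \<open>Coordinate \<open>i\<close> of the curve takes the ternary positions congruent to
  \<open>i\<close> modulo 3 and reads them as a binary expansion. Only \<open>i = 0, 1, 2\<close>
  are of interest.\<close>

definition schoenberg_curve :: "nat \<Rightarrow> real \<Rightarrow> real" where
  "schoenberg_curve i t = (\<Sum>k. schoenberg_wave (3 ^ (3 * k + i) * t) / 2 ^ Suc k)"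

lemma half_powers_sums: "(\<lambda>k. 1 / 2 ^ Suc k) sums (1::real)"
  using power_half_series by (simp add: power_divide)

lemma schoenberg_curve_term_bound:
  "norm (schoenberg_wave s / 2 ^ Suc k) \<le> 1 / 2 ^ Suc k"
  using schoenberg_wave_bounds[of s] by (simp add: divide_right_mono)

lemma schoenberg_curve_summable: "summable (\<lambda>k. schoenberg_wave (3 ^ (3 * k + i) * t) / 2 ^ Suc k)"
  by (rule summable_comparison_test'[OF sums_summable[OF half_powers_sums]])
    (rule schoenberg_curve_term_bound)

lemma schoenberg_curve_bounds: "0 \<le> schoenberg_curve i t" "schoenberg_curve i t \<le> 1"
proof -
  show "0 \<le> schoenberg_curve i t"
    unfolding schoenberg_curve_def
    by (rule suminf_nonneg[OF schoenberg_curve_summable]) (simp add: schoenberg_wave_bounds)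
  have "schoenberg_curve i t \<le> (\<Sum>k. 1 / 2 ^ Suc k)"
    unfolding schoenberg_curve_def
    by (rule suminf_le[OF _ schoenberg_curve_summable sums_summable[OF half_powers_sums]])
      (simp add: divide_right_mono schoenberg_wave_bounds)
  then show "schoenberg_curve i t \<le> 1"
    using half_powers_sums by (simp add: sums_iff)
qed

text \<open>The Weierstrass test with the geometric majorant makes the partial sums, which are
  continuous, converge uniformly.\<close>

lemma schoenberg_curve_continuous: "continuous_on UNIV (schoenberg_curve i)"
proof -
  have "uniform_limit UNIV (\<lambda>n t. \<Sum>k<n. schoenberg_wave (3 ^ (3 * k + i) * t) / 2 ^ Suc k)
      (schoenberg_curve i) sequentially"
    unfolding schoenberg_curve_def
    by (rule Weierstrass_m_test[OF _ sums_summable[OF half_powers_sums]])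
      (rule schoenberg_curve_term_bound)
  then show ?thesis
    by (rule uniform_limit_theorem[rotated])
      (auto simp: schoenberg_wave_def intro!: always_eventually continuous_intros)
qed

text \<open>Position \<open>3 * k + i\<close> carries binary digit \<open>k\<close> of coordinate
  \<open>i\<close>, matching the positions read by \<open>schoenberg_curve\<close>; only
  \<open>x 0\<close>, \<open>x 1\<close> and \<open>x 2\<close> enter.\<close>

definition interleaved_code :: "(nat \<Rightarrow> real) \<Rightarrow> real" where
  "interleaved_code x = cantor_code (\<lambda>k. dyadic_digit (k div 3) (x (k mod 3)))"

lemma interleaved_code_bounds: "0 \<le> interleaved_code x" "interleaved_code x \<le> 1"
  unfolding interleaved_code_def by (rule cantor_code_bounds, rule dyadic_digit_01)+

lemma schoenberg_curve_interleaved_code: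
  assumes "i < 3" "0 \<le> x i" "x i < 1"
  shows "schoenberg_curve i (interleaved_code x) = x i"
proof -
  have "schoenberg_wave (3 ^ (3 * k + i) * interleaved_code x) = dyadic_digit k (x i)" for k
  proof -
    have "schoenberg_wave (3 ^ (3 * k + i) * interleaved_code x)
        = dyadic_digit ((3 * k + i) div 3) (x ((3 * k + i) mod 3))"
      unfolding interleaved_code_def by (rule schoenberg_wave_cantor_code) (rule dyadic_digit_01)
    then show ?thesis using assms(1) by simp
  qed
  then show ?thesis
    using dyadic_expansion[OF assms(2,3)] by (simp add: schoenberg_curve_def sums_iff)
qed

subsection \<open>Compactness for Laplace transforms on the octant\<close>

definition coord3 :: "real \<times> real \<times> real \<Rightarrow> nat \<Rightarrow> real" where
  "coord3 l i = (if i = 0 then fst l else if i = 1 then fst (snd l) else snd (snd l))"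

text \<open>The clamp \<open>max 0\<close> keeps every coordinate in [0, 1) for arbitrary arguments,
  so the code is a total map; inside the octant it changes nothing.\<close>

definition octant_code :: "real \<times> real \<times> real \<Rightarrow> real" where
  "octant_code l = interleaved_code (\<lambda>i. 1 - exp (- max 0 (coord3 l i)))"

text \<open>The code is a pointwise series of measurable digits. Since digits jump, measurability
  cannot come from continuity.\<close>

lemma octant_code_measurable [measurable]: "octant_code \<in> borel_measurable borel"
proof -
  have [measurable]: "(\<lambda>l. coord3 l i) \<in> borel_measurable borel" for i
    unfolding coord3_def by (cases "i = 0"; cases "i = 1") (simp_all add: borel_prod[symmetric])
  show ?thesis
    unfolding octant_code_def interleaved_code_def cantor_code_def by measurable
qed

lemma schoenberg_curve_octant_code:
  assumes "i < 3" "0 \<le> coord3 l i"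
  shows "schoenberg_curve i (octant_code l) = 1 - exp (- coord3 l i)"
  unfolding octant_code_def
  by (subst schoenberg_curve_interleaved_code) (use assms in auto)

text \<open>
  The points at infinity correspond to curve coordinate \<open>1\<close>, where \<open>0 powr w = 0\<close> makes the
  kernel vanish, as it should.
\<close>
definition octant_kernel :: "real \<Rightarrow> real \<Rightarrow> real \<Rightarrow> real \<Rightarrow> real" where
  "octant_kernel w1 w2 w3 t = (1 - schoenberg_curve 0 t) powr w1 *
     (1 - schoenberg_curve 1 t) powr w2 * (1 - schoenberg_curve 2 t) powr w3"

text \<open>Along the code, one minus a curve coordinate is \<open>exp (- l)\<close>, whose power
  \<open>w\<close> is \<open>exp (- l * w)\<close>.\<close>

lemma octant_kernel_octant_code:
  assumes "0 \<le> l1" "0 \<le> l2" "0 \<le> l3"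
  shows "octant_kernel w1 w2 w3 (octant_code (l1, l2, l3)) = exp (- l1 * w1 - l2 * w2 - l3 * w3)"
proof -
  have "schoenberg_curve 0 (octant_code (l1, l2, l3)) = 1 - exp (- l1)"
    "schoenberg_curve 1 (octant_code (l1, l2, l3)) = 1 - exp (- l2)"
    "schoenberg_curve 2 (octant_code (l1, l2, l3)) = 1 - exp (- l3)"
    using assms by (subst schoenberg_curve_octant_code; simp add: coord3_def)+
  note eqs = this
  show ?thesis
    unfolding octant_kernel_def eqs by (simp add: powr_def exp_add[symmetric] algebra_simps)
qed

lemma octant_kernel_bounds:
  assumes "0 < w1" "0 < w2" "0 < w3"
  shows "0 \<le> octant_kernel w1 w2 w3 t" "octant_kernel w1 w2 w3 t \<le> 1"
proof -
  have "(1 - schoenberg_curve i t) powr w \<le> 1" if "0 < w" for i w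
    using schoenberg_curve_bounds[of i t] that by (intro powr_le1) auto
  then show "octant_kernel w1 w2 w3 t \<le> 1"
    unfolding octant_kernel_def using assms by (intro mult_le_one) auto
qed (simp add: octant_kernel_def)

text \<open>The critical points are those where a curve coordinate equals 1: there the base of the
  power is 0, and continuity rests on the exponent being positive.\<close>

lemma octant_kernel_continuous:
  assumes "0 < w1" "0 < w2" "0 < w3"
  shows "continuous_on UNIV (octant_kernel w1 w2 w3)"
proof -
  have "continuous_on UNIV (\<lambda>t. (1 - schoenberg_curve i t) powr w)" if "0 < w" for i w
    by (rule continuous_on_powr')
      (use that schoenberg_curve_bounds[of i] in \<open>auto intro!: continuous_intros schoenberg_curve_continuous\<close>)
  then show ?thesis
    unfolding octant_kernel_def using assms by (intro continuous_on_mult) auto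
qed

lemma octant_kernel_measurable [measurable]:
  "octant_kernel w1 w2 w3 \<in> borel_measurable borel"
proof -
  have [measurable]: "schoenberg_curve i \<in> borel_measurable borel" for i
    by (rule borel_measurable_continuous_onI) (rule schoenberg_curve_continuous)
  show ?thesis unfolding octant_kernel_def by measurable
qed

lemma octant_sets:
  "{l :: real \<times> real \<times> real. case l of (l1, l2, l3) \<Rightarrow> 0 \<le> l1 \<and> 0 \<le> l2 \<and> 0 \<le> l3} \<in> sets borel"
  unfolding case_prod_beta
  by (intro borel_closed closed_Collect_conj closed_Collect_le continuous_intros)

text \<open>The measures are pushed to [0, 1] by the code, where Helly's theorem yields a weakly
  convergent subsequence. The exponentials become the bounded continuous functions
  \<open>octant_kernel\<close>, so their integrals converge. The limit need not live on the range of
  the code, but decoding by the curve makes sense for every parameter. Mass that has escaped to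
  infinity is dropped, so \<nu> may have total mass below 1.\<close>

lemma octant_laplace_selection:
  fixes N :: "nat \<Rightarrow> (real \<times> real \<times> real) measure"
  assumes prob: "\<And>n. prob_space (N n)" and sets: "\<And>n. sets (N n) = sets borel"
    and nonneg: "\<And>n. AE (l1, l2, l3) in N n. 0 \<le> l1 \<and> 0 \<le> l2 \<and> 0 \<le> l3"
  obtains r :: "nat \<Rightarrow> nat" and \<nu> :: "(real \<times> real \<times> real) measure"
  where "strict_mono r" "sets \<nu> = sets borel"
    "AE (l1, l2, l3) in \<nu>. 0 \<le> l1 \<and> 0 \<le> l2 \<and> 0 \<le> l3"
    "\<And>w1 w2 w3. 0 < w1 \<Longrightarrow> 0 < w2 \<Longrightarrow> 0 < w3 \<Longrightarrow>
      (\<lambda>k. \<integral>\<^sup>+ (l1, l2, l3). ennreal (exp (- l1 * w1 - l2 * w2 - l3 * w3)) \<partial>N (r k))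
      \<longlonglongrightarrow> (\<integral>\<^sup>+ (l1, l2, l3). ennreal (exp (- l1 * w1 - l2 * w2 - l3 * w3)) \<partial>\<nu>)"
proof -
  have meas [measurable]: "octant_code \<in> borel_measurable (N n)" for n
    using octant_code_measurable sets[of n] by (simp cong: measurable_cong_sets)
  define \<mu> where "\<mu> n = distr (N n) borel octant_code" for n
  have rd: "real_distribution (\<mu> n)" for n
    unfolding \<mu>_def using prob[of n] by (rule prob_space.real_distribution_distr) measurable
  have "tight \<mu>"
    unfolding tight_def
  proof (intro conjI allI impI)
    fix e :: real assume "e > 0"
    \<comment> \<open>Tightness is stated with left-open intervals; the endpoint -1 leaves room for
      the code value 0.\<close>
    have "measure (\<mu> n) {-1<..1} = 1" for n
    proof -
      interpret prob_space "N n" by (rule prob)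
      have "measure (\<mu> n) {-1<..1} = prob (octant_code -` {-1<..1} \<inter> space (N n))"
        unfolding \<mu>_def by (rule measure_distr) auto
      also have "octant_code -` {-1<..1} \<inter> space (N n) = space (N n)"
        using interleaved_code_bounds less_le_trans[OF _ interleaved_code_bounds(1), of "-1"]
        by (auto simp: octant_code_def)
      finally show ?thesis by (simp add: prob_space)
    qed
    then show "\<exists>a b. a < b \<and> (\<forall>n. measure (\<mu> n) {a<..b} > 1 - e)"
      using \<open>e > 0\<close> by (intro exI[of _ "-1"] exI[of _ 1]) simp
  qed (rule rd)
  from tight_imp_convergent_subsubsequence[OF this strict_mono_id]
  obtain r M where r: "strict_mono (r :: nat \<Rightarrow> nat)" and M: "real_distribution M"
    and conv: "weak_conv_m (\<lambda>k. \<mu> (r k)) M"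
    by (auto simp: o_def id_def)
  interpret M: real_distribution M by (rule M)
  have [measurable]: "schoenberg_curve i \<in> borel_measurable M" for i
    using borel_measurable_continuous_onI[OF schoenberg_curve_continuous] by simp
  \<comment> \<open>\<open>A\<close> collects the parameters whose decoded point is finite, and
    \<open>dec\<close> inverts \<lambda> \<mapsto> 1 - exp(-\<lambda>) in each coordinate.\<close>
  define A where "A = {t. \<forall>i\<in>{0,1,2}. schoenberg_curve i t < 1}"
  define dec where "dec t = (- ln (1 - schoenberg_curve 0 t), - ln (1 - schoenberg_curve 1 t),
    - ln (1 - schoenberg_curve 2 t))" for t
  have A [measurable]: "A \<in> sets M"
  proof -
    have "{t \<in> space M. \<forall>i\<in>{0,1,2}. schoenberg_curve i t < 1} \<in> sets M" by measurable
    then show ?thesis by (simp add: A_def)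
  qed
  have dec [measurable]: "dec \<in> measurable M borel"
    unfolding dec_def borel_prod[symmetric] by measurable
  define \<nu> where "\<nu> = distr (density M (indicator A)) borel dec"
  have lim: "(\<lambda>k. \<integral>\<^sup>+ (l1, l2, l3). ennreal (exp (- l1 * w1 - l2 * w2 - l3 * w3)) \<partial>N (r k))
      \<longlonglongrightarrow> (\<integral>\<^sup>+ (l1, l2, l3). ennreal (exp (- l1 * w1 - l2 * w2 - l3 * w3)) \<partial>\<nu>)"
    if w: "0 < w1" "0 < w2" "0 < w3" for w1 w2 w3
  proof -
    let ?F = "octant_kernel w1 w2 w3"
    have "(\<lambda>k. \<integral>t. ?F t \<partial>\<mu> (r k)) \<longlonglongrightarrow> (\<integral>t. ?F t \<partial>M)"
    proof (rule weak_conv_imp_integral_bdd_continuous_conv[where B = 1])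
      show "isCont ?F x" for x
        using octant_kernel_continuous[OF w] by (simp add: continuous_on_eq_continuous_at)
      show "norm (?F x) \<le> 1" for x
        using octant_kernel_bounds[OF w, of x] by simp
    qed (use rd M conv in auto)
    then have "(\<lambda>k. ennreal (\<integral>t. ?F t \<partial>\<mu> (r k))) \<longlonglongrightarrow> ennreal (\<integral>t. ?F t \<partial>M)"
      by (rule tendsto_ennrealI)
    moreover have int: "ennreal (\<integral>t. ?F t \<partial>D) = (\<integral>\<^sup>+t. ennreal (?F t) \<partial>D)"
      if "real_distribution D" for D
    proof -
      interpret D: real_distribution D by fact
      show ?thesis
        by (rule nn_integral_eq_integral[symmetric])
          (auto intro!: D.integrable_const_bound[of _ 1] simp: octant_kernel_bounds[OF w])
    qed
    moreover have "(\<integral>\<^sup>+t. ennreal (?F t) \<partial>\<mu> n) =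
        (\<integral>\<^sup>+ (l1, l2, l3). ennreal (exp (- l1 * w1 - l2 * w2 - l3 * w3)) \<partial>N n)" for n
      unfolding \<mu>_def
      by (subst nn_integral_distr)
        (use nonneg[of n] in \<open>auto intro!: nn_integral_cong_AE simp: octant_kernel_octant_code\<close>)
    moreover have "(\<integral>\<^sup>+t. ennreal (?F t) \<partial>M) =
        (\<integral>\<^sup>+ (l1, l2, l3). ennreal (exp (- l1 * w1 - l2 * w2 - l3 * w3)) \<partial>\<nu>)"
    proof -
      have kernel: "(\<lambda>(l1, l2, l3). ennreal (exp (- l1 * w1 - l2 * w2 - l3 * w3))) \<in> borel_measurable borel"
        unfolding borel_prod[symmetric] by measurable
      have dec': "dec \<in> measurable (density M (indicator A)) borel"
        by (subst measurable_cong_sets[OF sets_density refl]) (rule dec)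
      have "(\<integral>\<^sup>+ (l1, l2, l3). ennreal (exp (- l1 * w1 - l2 * w2 - l3 * w3)) \<partial>\<nu>) =
          (\<integral>\<^sup>+ t. (case dec t of (l1, l2, l3) \<Rightarrow> ennreal (exp (- l1 * w1 - l2 * w2 - l3 * w3)))
            \<partial>density M (indicator A))"
        unfolding \<nu>_def by (rule nn_integral_distr[OF dec']) (subst measurable_distr_eq1, rule kernel)
      also have "\<dots> = (\<integral>\<^sup>+ t. indicator A t *
          (case dec t of (l1, l2, l3) \<Rightarrow> ennreal (exp (- l1 * w1 - l2 * w2 - l3 * w3))) \<partial>M)"
        using A by (intro nn_integral_density measurable_compose[OF dec kernel]) measurable
      also have "\<dots> = (\<integral>\<^sup>+t. ennreal (?F t) \<partial>M)"
      proof (rule nn_integral_cong)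
        fix t
        have b: "schoenberg_curve i t \<le> 1" for i by (rule schoenberg_curve_bounds)
        show "indicator A t * (case dec t of (l1, l2, l3) \<Rightarrow>
            ennreal (exp (- l1 * w1 - l2 * w2 - l3 * w3))) = ennreal (?F t)"
        proof (cases "t \<in> A")
          case True
          then show ?thesis
            by (auto simp: A_def dec_def octant_kernel_def powr_def exp_add[symmetric] algebra_simps)
        next
          \<comment> \<open>Off \<open>A\<close> some curve coordinate is exactly 1, so the kernel
            vanishes together with the indicator; hence discarding this mass loses nothing in the
            integral.\<close>
          case False
          then obtain i where "i \<in> {0,1,2}" "\<not> schoenberg_curve i t < 1"
            unfolding A_def by blast
          moreover from this b[of i] have "schoenberg_curve i t = 1" by simp
          ultimately show ?thesis using False by (auto simp: octant_kernel_def)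
        qed
      qed
      finally show ?thesis ..
    qed
    ultimately show ?thesis using rd M by simp
  qed
  show thesis
  proof (rule that[OF r _ _ lim])
    show "sets \<nu> = sets borel" by (simp add: \<nu>_def)
    \<comment> \<open>This holds even off \<open>A\<close>, where the convention
      \<open>ln 0 = 0\<close> applies.\<close>
    have "0 \<le> - ln (1 - schoenberg_curve i t)" for i t
      using schoenberg_curve_bounds[of i t] by (cases "schoenberg_curve i t = 1") auto
    then have "AE t in density M (indicator A). case dec t of (l1, l2, l3) \<Rightarrow> 0 \<le> l1 \<and> 0 \<le> l2 \<and> 0 \<le> l3"
      by (simp add: dec_def)
    then show "AE (l1, l2, l3) in \<nu>. 0 \<le> l1 \<and> 0 \<le> l2 \<and> 0 \<le> l3"
      unfolding \<nu>_def using octant_sets by (subst AE_distr_iff) auto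
  qed
qed

subsection \<open>Gamma combinations and their limits\<close>

text \<open>Independence factorises the exponential moment into one-dimensional Gamma transforms.
  The coefficients \<open>d\<close> are left free so that the same formula serves both the given
  planar vector and the three-dimensional vector of the symmetrised product.\<close>

lemma gamma_combination_law_obtains:
  assumes "gamma_combination_law n \<mu>"
  obtains \<Omega> :: "(nat \<Rightarrow> real) measure"
    and \<gamma> c1 c2 :: "nat \<Rightarrow> real" and Y :: "nat \<Rightarrow> (nat \<Rightarrow> real) \<Rightarrow> real"
  where "prob_space \<Omega>"
    "\<And>j. j \<in> {1..n} \<Longrightarrow> 0 < \<gamma> j \<and> 0 \<le> c1 j \<and> 0 \<le> c2 j"
    "\<And>j. j \<in> {1..n} \<Longrightarrow> Y j \<in> borel_measurable \<Omega>"
    "AE \<omega> in \<Omega>. \<forall>j\<in>{1..n}. 0 \<le> Y j \<omega>"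
    "\<And>d. (\<And>j. j \<in> {1..n} \<Longrightarrow> 0 \<le> d j) \<Longrightarrow>
      (\<integral>\<^sup>+ \<omega>. ennreal (exp (- (\<Sum>j=1..n. d j * Y j \<omega>))) \<partial>\<Omega>)
        = ennreal (\<Prod>j=1..n. (1 + d j) powr - \<gamma> j)"
    "\<mu> = distr \<Omega> borel (\<lambda>\<omega>. (\<Sum>j=1..n. c1 j * Y j \<omega>, \<Sum>j=1..n. c2 j * Y j \<omega>))"
proof -
  obtain \<Omega> :: "(nat \<Rightarrow> real) measure" and Y \<gamma> c1 c2 where prob: "prob_space \<Omega>"
    and indep: "prob_space.indep_vars \<Omega> (\<lambda>_. borel) Y {1..n}"
    and pos: "\<And>j. j \<in> {1..n} \<Longrightarrow> 0 < \<gamma> j \<and> 0 \<le> c1 j \<and> 0 \<le> c2 j"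
    and dist: "\<And>j. j \<in> {1..n} \<Longrightarrow>
      distributed \<Omega> lborel (Y j) (\<lambda>x. ennreal (gamma_density (\<gamma> j) x))"
    and \<mu>: "\<mu> = distr \<Omega> borel (\<lambda>\<omega>. (\<Sum>j=1..n. c1 j * Y j \<omega>, \<Sum>j=1..n. c2 j * Y j \<omega>))"
    using assms unfolding gamma_combination_law_def by blast
  interpret prob_space \<Omega> by (rule prob)
  have Y: "Y j \<in> borel_measurable \<Omega>" if "j \<in> {1..n}" for j
    using distributed_measurable[OF dist[OF that]] by simp
  have "AE \<omega> in \<Omega>. 0 \<le> Y j \<omega>" if j: "j \<in> {1..n}" for j
  proof -
    have "AE x in density lborel (\<lambda>x. ennreal (gamma_density (\<gamma> j) x)). 0 \<le> x"
      using distributed_borel_measurable[OF dist[OF j]]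
      by (subst AE_density) (auto simp: gamma_density_def)
    then have "AE x in distr \<Omega> lborel (Y j). 0 \<le> x"
      unfolding distributed_distr_eq_density[OF dist[OF j]] .
    then show ?thesis
      by (rule AE_distrD[rotated]) (use Y[OF j] in simp)
  qed
  then have AE: "AE \<omega> in \<Omega>. \<forall>j\<in>{1..n}. 0 \<le> Y j \<omega>"
    by (simp add: AE_ball_countable)
  have laplace: "(\<integral>\<^sup>+ \<omega>. ennreal (exp (- (\<Sum>j=1..n. d j * Y j \<omega>))) \<partial>\<Omega>)
        = ennreal (\<Prod>j=1..n. (1 + d j) powr - \<gamma> j)"
    if d: "\<And>j. j \<in> {1..n} \<Longrightarrow> 0 \<le> d j" for d
  proof -
    have "(\<integral>\<^sup>+ \<omega>. ennreal (exp (- (\<Sum>j=1..n. d j * Y j \<omega>))) \<partial>\<Omega>)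
        = (\<integral>\<^sup>+ \<omega>. (\<Prod>j=1..n. ennreal (exp (- d j * Y j \<omega>))) \<partial>\<Omega>)"
      by (simp add: sum_negf[symmetric] exp_sum prod_ennreal)
    also have "\<dots> = (\<Prod>j=1..n. \<integral>\<^sup>+ \<omega>. ennreal (exp (- d j * Y j \<omega>)) \<partial>\<Omega>)"
    proof (rule indep_vars_nn_integral)
      show "indep_vars (\<lambda>_. borel) (\<lambda>j \<omega>. ennreal (exp (- d j * Y j \<omega>))) {1..n}"
        by (rule indep_vars_compose2[OF indep]) measurable
    qed auto
    also have "\<dots> = (\<Prod>j=1..n. ennreal ((1 + d j) powr - \<gamma> j))"
    proof (rule prod.cong[OF refl])
      fix j assume j: "j \<in> {1..n}"
      have "(\<integral>\<^sup>+ \<omega>. ennreal (exp (- d j * Y j \<omega>)) \<partial>\<Omega>) =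
          (\<integral>\<^sup>+x. ennreal (gamma_density (\<gamma> j) x) * ennreal (exp (- d j * x)) \<partial>lborel)"
        by (rule distributed_nn_integral[OF dist[OF j], symmetric]) measurable
      then show "(\<integral>\<^sup>+ \<omega>. ennreal (exp (- d j * Y j \<omega>)) \<partial>\<Omega>) = ennreal ((1 + d j) powr - \<gamma> j)"
        using gamma_density_laplace[of "\<gamma> j" "d j"] pos[OF j] d[OF j] by simp
    qed
    also have "\<dots> = ennreal (\<Prod>j=1..n. (1 + d j) powr - \<gamma> j)"
      by (rule prod_ennreal) simp
    finally show ?thesis .
  qed
  show thesis by (rule that[OF prob pos Y AE laplace \<mu>])
qed

lemma gamma_combination_law_quadrant:
  assumes "gamma_combination_law n \<mu>"
  shows "quadrant_distribution \<mu>"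
proof -
  from assms obtain \<Omega> :: "(nat \<Rightarrow> real) measure" and \<gamma> c1 c2 :: "nat \<Rightarrow> real"
    and Y :: "nat \<Rightarrow> (nat \<Rightarrow> real) \<Rightarrow> real" where prob: "prob_space \<Omega>"
    and pos: "\<And>j. j \<in> {1..n} \<Longrightarrow> 0 < \<gamma> j \<and> 0 \<le> c1 j \<and> 0 \<le> c2 j"
    and Y [measurable]: "\<And>j. j \<in> {1..n} \<Longrightarrow> Y j \<in> borel_measurable \<Omega>"
    and AE: "AE \<omega> in \<Omega>. \<forall>j\<in>{1..n}. 0 \<le> Y j \<omega>"
    and "\<And>d. (\<And>j. j \<in> {1..n} \<Longrightarrow> 0 \<le> d j) \<Longrightarrow>
      (\<integral>\<^sup>+ \<omega>. ennreal (exp (- (\<Sum>j=1..n. d j * Y j \<omega>))) \<partial>\<Omega>)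
        = ennreal (\<Prod>j=1..n. (1 + d j) powr - \<gamma> j)"
    and \<mu>: "\<mu> = distr \<Omega> borel (\<lambda>\<omega>. (\<Sum>j=1..n. c1 j * Y j \<omega>, \<Sum>j=1..n. c2 j * Y j \<omega>))"
    by (rule gamma_combination_law_obtains) blast
  have Z: "(\<lambda>\<omega>. (\<Sum>j=1..n. c1 j * Y j \<omega>, \<Sum>j=1..n. c2 j * Y j \<omega>)) \<in> measurable \<Omega> borel"
    unfolding borel_prod[symmetric] by measurable
  have "{x :: real \<times> real. 0 \<le> fst x \<and> 0 \<le> snd x} \<in> sets borel"
    by (intro borel_closed closed_Collect_conj closed_Collect_le continuous_intros)
  then have "AE x in \<mu>. 0 \<le> fst x \<and> 0 \<le> snd x"
    unfolding \<mu> using AE pos by (subst AE_distr_iff[OF Z]) (auto intro!: sum_nonneg)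
  then show ?thesis
    using prob_space.prob_space_distr[OF prob Z] unfolding quadrant_distribution_def \<mu> by simp
qed

section \<open>The symmetrised Laplace transform of a Gamma combination\<close>

lemma laplace_symmetric_factor:
  fixes a b v1 v2 :: real
  assumes v: "0 < v1" "0 < v2"
  shows "(1 + (a * v1 + b * v2)) * (1 + (a / v1 + b / v2)) =
    (1 + a\<^sup>2 + b\<^sup>2) + (a * (v1 + 1 / v1) + b * (v2 + 1 / v2) + a * b * (v1 / v2 + v2 / v1))"
  using v by (simp add: field_simps power2_eq_square)

text \<open>Each factor of the product has the form \<open>K j + L j\<close> with \<open>K j\<close>
  constant and \<open>L j\<close> linear in the three variables w. Writing it as
  \<open>K j * (1 + L j / K j)\<close> separates the constant \<open>p\<close> from the Laplace
  transform of a probability law. Keeping \<open>p\<close> apart, with 0 \<le> p \<le> 1, lets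
  compactness be applied to \<open>N\<close> and to \<open>p\<close> separately.\<close>

lemma gamma_combination_law_representation:
  assumes law: "gamma_combination_law n \<mu>" and u: "0 < u1" "0 < u2"
  shows "\<exists>p N. 0 \<le> p \<and> p \<le> 1 \<and> prob_space N \<and> sets N = sets borel \<and>
    (AE (l1, l2, l3) in N. 0 \<le> l1 \<and> 0 \<le> l2 \<and> 0 \<le> l3) \<and>
    (\<forall>v1>0. \<forall>v2>0.
      ennreal (laplace_transform \<mu> (u1 * v1) (u2 * v2) * laplace_transform \<mu> (u1 / v1) (u2 / v2)) =
      ennreal p * (\<integral>\<^sup>+ (l1, l2, l3). ennreal (exp (- l1 * (v1 + 1 / v1) - l2 * (v2 + 1 / v2)
        - l3 * (v1 / v2 + v2 / v1))) \<partial>N))"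
proof -
  from law obtain \<Omega> :: "(nat \<Rightarrow> real) measure" and \<gamma> c1 c2 :: "nat \<Rightarrow> real"
    and Y :: "nat \<Rightarrow> (nat \<Rightarrow> real) \<Rightarrow> real" where prob: "prob_space \<Omega>"
    and pos: "\<And>j. j \<in> {1..n} \<Longrightarrow> 0 < \<gamma> j \<and> 0 \<le> c1 j \<and> 0 \<le> c2 j"
    and Y [measurable]: "\<And>j. j \<in> {1..n} \<Longrightarrow> Y j \<in> borel_measurable \<Omega>"
    and AE: "AE \<omega> in \<Omega>. \<forall>j\<in>{1..n}. 0 \<le> Y j \<omega>"
    and laplace: "\<And>d. (\<And>j. j \<in> {1..n} \<Longrightarrow> 0 \<le> d j) \<Longrightarrow>
      (\<integral>\<^sup>+ \<omega>. ennreal (exp (- (\<Sum>j=1..n. d j * Y j \<omega>))) \<partial>\<Omega>)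
        = ennreal (\<Prod>j=1..n. (1 + d j) powr - \<gamma> j)"
    and \<mu>: "\<mu> = distr \<Omega> borel (\<lambda>\<omega>. (\<Sum>j=1..n. c1 j * Y j \<omega>, \<Sum>j=1..n. c2 j * Y j \<omega>))"
    by (rule gamma_combination_law_obtains) blast
  interpret prob_space \<Omega> by (rule prob)
  have Z: "(\<lambda>\<omega>. (\<Sum>j=1..n. c1 j * Y j \<omega>, \<Sum>j=1..n. c2 j * Y j \<omega>)) \<in> measurable \<Omega> borel"
    unfolding borel_prod[symmetric] by measurable
  have LT: "laplace_transform \<mu> s1 s2 = (\<Prod>j=1..n. (1 + (c1 j * s1 + c2 j * s2)) powr - \<gamma> j)"
    if s: "0 \<le> s1" "0 \<le> s2" for s1 s2
  proof -
    have "laplace_transform \<mu> s1 s2 =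
        (\<integral>\<omega>. exp (- (\<Sum>j=1..n. (c1 j * s1 + c2 j * s2) * Y j \<omega>)) \<partial>\<Omega>)"
      unfolding laplace_transform_def \<mu>
      by (subst integral_distr[OF Z])
        (auto simp: borel_prod[symmetric] sum_distrib_left sum.distrib sum_negf algebra_simps)
    also have "\<dots> = enn2real (\<integral>\<^sup>+\<omega>. ennreal (exp (- (\<Sum>j=1..n. (c1 j * s1 + c2 j * s2) * Y j \<omega>))) \<partial>\<Omega>)"
      by (rule integral_eq_nn_integral) auto
    also have "\<dots> = (\<Prod>j=1..n. (1 + (c1 j * s1 + c2 j * s2)) powr - \<gamma> j)"
      by (subst laplace) (use pos s in \<open>auto simp: prod_nonneg\<close>)
    finally show ?thesis .
  qed
  define a where "a j = c1 j * u1" for j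
  define b where "b j = c2 j * u2" for j
  define K where "K j = 1 + (a j)\<^sup>2 + (b j)\<^sup>2" for j
  define p where "p = (\<Prod>j=1..n. K j powr - \<gamma> j)"
  have K: "1 \<le> K j" for j by (simp add: K_def)
  have ab: "0 \<le> a j" "0 \<le> b j" if "j \<in> {1..n}" for j
    using pos[OF that] u by (auto simp: a_def b_def)
  have p: "0 \<le> p" "p \<le> 1"
  proof -
    show "0 \<le> p" by (auto simp: p_def intro!: prod_nonneg)
    have "K j powr - \<gamma> j \<le> 1" if "j \<in> {1..n}" for j
      using powr_mono[of "- \<gamma> j" 0 "K j"] K[of j] pos[OF that] by simp
    then show "p \<le> 1" unfolding p_def by (intro prod_le_1) auto
  qed
  \<comment> \<open>The coefficients are those of w1, w2 and w3 in the symmetric factor, divided by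
    the constant term \<open>K j\<close>.\<close>
  define V where "V \<omega> = (\<Sum>j=1..n. a j / K j * Y j \<omega>, \<Sum>j=1..n. b j / K j * Y j \<omega>,
    \<Sum>j=1..n. a j * b j / K j * Y j \<omega>)" for \<omega>
  have V: "V \<in> measurable \<Omega> borel"
    unfolding V_def borel_prod[symmetric] by measurable
  let ?N = "distr \<Omega> borel V"
  have "0 \<le> K j" for j using K[of j] by simp
  then have nonneg: "AE (l1, l2, l3) in ?N. 0 \<le> l1 \<and> 0 \<le> l2 \<and> 0 \<le> l3"
    using AE ab octant_sets by (subst AE_distr_iff[OF V]) (auto simp: V_def intro!: sum_nonneg)
  have rep: "ennreal (laplace_transform \<mu> (u1 * v1) (u2 * v2) * laplace_transform \<mu> (u1 / v1) (u2 / v2)) =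
      ennreal p * (\<integral>\<^sup>+ (l1, l2, l3). ennreal (exp (- l1 * (v1 + 1 / v1) - l2 * (v2 + 1 / v2)
        - l3 * (v1 / v2 + v2 / v1))) \<partial>?N)" if v: "0 < v1" "0 < v2" for v1 v2
  proof -
    define L where "L j = a j * (v1 + 1 / v1) + b j * (v2 + 1 / v2) + a j * b j * (v1 / v2 + v2 / v1)" for j
    have L: "0 \<le> L j" if "j \<in> {1..n}" for j
      using ab[OF that] v by (simp add: L_def)
    have "(\<integral>\<^sup>+ (l1, l2, l3). ennreal (exp (- l1 * (v1 + 1 / v1) - l2 * (v2 + 1 / v2)
        - l3 * (v1 / v2 + v2 / v1))) \<partial>?N) = (\<integral>\<^sup>+ \<omega>. ennreal (exp (- (\<Sum>j=1..n. L j / K j * Y j \<omega>))) \<partial>\<Omega>)"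
    proof (subst nn_integral_distr[OF V])
      have "(\<Sum>j=1..n. L j / K j * Y j \<omega>) = (\<Sum>j=1..n. a j / K j * Y j \<omega>) * (v1 + 1 / v1)
          + (\<Sum>j=1..n. b j / K j * Y j \<omega>) * (v2 + 1 / v2)
          + (\<Sum>j=1..n. a j * b j / K j * Y j \<omega>) * (v1 / v2 + v2 / v1)" for \<omega>
        unfolding sum_distrib_right sum.distrib[symmetric]
        by (rule sum.cong) (simp_all add: L_def add_divide_distrib distrib_left distrib_right mult_ac)
      then show "(\<integral>\<^sup>+ \<omega>. (case V \<omega> of (l1, l2, l3) \<Rightarrow> ennreal (exp (- l1 * (v1 + 1 / v1) - l2 * (v2 + 1 / v2)
          - l3 * (v1 / v2 + v2 / v1)))) \<partial>\<Omega>) = (\<integral>\<^sup>+ \<omega>. ennreal (exp (- (\<Sum>j=1..n. L j / K j * Y j \<omega>))) \<partial>\<Omega>)"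
        by (simp add: V_def algebra_simps)
    qed (simp add: borel_prod[symmetric])
    also have "\<dots> = ennreal (\<Prod>j=1..n. (1 + L j / K j) powr - \<gamma> j)"
      by (rule laplace) (use L K in \<open>auto intro!: divide_nonneg_nonneg intro: order_trans[OF zero_le_one]\<close>)
    also have "ennreal p * \<dots> = ennreal (\<Prod>j=1..n. K j powr - \<gamma> j * (1 + L j / K j) powr - \<gamma> j)"
      using p by (subst ennreal_mult'[symmetric]) (simp_all add: p_def prod.distrib)
    also have "(\<Prod>j=1..n. K j powr - \<gamma> j * (1 + L j / K j) powr - \<gamma> j) =
        (\<Prod>j=1..n. (1 + (c1 j * (u1 * v1) + c2 j * (u2 * v2))) powr - \<gamma> j *
          (1 + (c1 j * (u1 / v1) + c2 j * (u2 / v2))) powr - \<gamma> j)"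
    proof (rule prod.cong[OF refl])
      fix j assume j: "j \<in> {1..n}"
      have "K j > 0" using K[of j] by linarith
      have "K j powr - \<gamma> j * (1 + L j / K j) powr - \<gamma> j = (K j * (1 + L j / K j)) powr - \<gamma> j"
        by (rule powr_mult[symmetric])
      also have "K j * (1 + L j / K j) = K j + L j"
        using \<open>K j > 0\<close> by (simp add: distrib_left)
      also have "\<dots> = (1 + (a j * v1 + b j * v2)) * (1 + (a j / v1 + b j / v2))"
        unfolding laplace_symmetric_factor[OF v] by (simp add: K_def L_def)
      also have "\<dots> powr - \<gamma> j = (1 + (a j * v1 + b j * v2)) powr - \<gamma> j * (1 + (a j / v1 + b j / v2)) powr - \<gamma> j"
        by (rule powr_mult)
      finally show "K j powr - \<gamma> j * (1 + L j / K j) powr - \<gamma> j =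
          (1 + (c1 j * (u1 * v1) + c2 j * (u2 * v2))) powr - \<gamma> j *
          (1 + (c1 j * (u1 / v1) + c2 j * (u2 / v2))) powr - \<gamma> j"
        by (simp add: a_def b_def mult.assoc)
    qed
    finally show ?thesis
      using u v by (simp add: LT prod.distrib)
  qed
  show ?thesis
    using p prob_space_distr[OF V] nonneg rep by (intro exI[of _ p] exI[of _ ?N]) simp
qed

section \<open>Passage to the limit\<close>

lemma laplace_transform_converges:
  assumes conv: "converges_in_distribution \<mu>s \<mu>"
    and q: "\<And>n. quadrant_distribution (\<mu>s n)" "quadrant_distribution \<mu>"
    and s: "0 \<le> s1" "0 \<le> s2"
  shows "(\<lambda>n. laplace_transform (\<mu>s n) s1 s2) \<longlonglongrightarrow> laplace_transform \<mu> s1 s2"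
proof -
  \<comment> \<open>The exponential need not be bounded on the whole plane. Clamping the coordinates
    at 0 gives a bounded continuous test function that agrees with it almost everywhere for
    distributions on the quadrant.\<close>
  let ?f = "\<lambda>x :: real \<times> real. exp (- s1 * max 0 (fst x) - s2 * max 0 (snd x))"
  have "laplace_transform N s1 s2 = (\<integral>x. ?f x \<partial>N)" if N: "quadrant_distribution N" for N
    unfolding laplace_transform_def
  proof (rule integral_cong_AE)
    have [measurable_cong]: "sets N = sets (borel \<Otimes>\<^sub>M borel)"
      using N unfolding quadrant_distribution_def borel_prod by blast
    show "(\<lambda>x. exp (- s1 * fst x - s2 * snd x)) \<in> borel_measurable N" by measurable
    show "?f \<in> borel_measurable N" by measurable
    have "AE x in N. 0 \<le> fst x \<and> 0 \<le> snd x"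
      using N by (simp add: quadrant_distribution_def)
    then show "AE x in N. exp (- s1 * fst x - s2 * snd x) = ?f x"
      by eventually_elim (simp add: max_def)
  qed
  moreover have "(\<lambda>n. \<integral>x. ?f x \<partial>\<mu>s n) \<longlonglongrightarrow> (\<integral>x. ?f x \<partial>\<mu>)"
  proof -
    have "continuous_on UNIV ?f" by (intro continuous_intros)
    moreover have "bounded (range ?f)"
    proof (rule boundedI[where B = 1])
      fix y assume "y \<in> range ?f"
      then obtain x where y: "y = ?f x" by blast
      have "0 \<le> s1 * max 0 (fst x)" "0 \<le> s2 * max 0 (snd x)" using s by simp_all
      then show "norm y \<le> 1" unfolding y by simp
    qed
    ultimately show ?thesis using conv by (simp add: converges_in_distribution_def)
  qed
  ultimately show ?thesis using q by simp
qed

text \<open>One subsequence makes the constants \<open>p n\<close> converge to \<open>P\<close>, a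
  further one makes the transforms of the laws \<open>N n\<close> converge to that of \<nu>. The
  left-hand sides converge along the full sequence, so uniqueness of limits represents the limiting
  product by \<nu> scaled with \<open>P\<close>.\<close>

lemma BVGGC_strong_imp_BVHCM_laplace:
  assumes "BVGGC_strong \<mu>"
  shows "BVHCM (laplace_transform \<mu>)"
  unfolding BVHCM_def
proof (intro conjI allI impI)
  fix x y :: real
  show "0 \<le> laplace_transform \<mu> x y"
    unfolding laplace_transform_def by (rule Bochner_Integration.integral_nonneg) simp
next
  fix u1 u2 :: real assume u: "0 < u1" "0 < u2"
  obtain \<mu>s where q: "quadrant_distribution \<mu>" and law: "\<And>n. gamma_combination_law n (\<mu>s n)"
    and conv: "converges_in_distribution \<mu>s \<mu>"
    using assms unfolding BVGGC_strong_def by blast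
  have "\<exists>p N. \<forall>n. 0 \<le> p n \<and> p n \<le> 1 \<and> prob_space (N n) \<and> sets (N n) = sets borel \<and>
    (AE (l1, l2, l3) in N n. 0 \<le> l1 \<and> 0 \<le> l2 \<and> 0 \<le> l3) \<and>
    (\<forall>v1>0. \<forall>v2>0.
      ennreal (laplace_transform (\<mu>s n) (u1 * v1) (u2 * v2) * laplace_transform (\<mu>s n) (u1 / v1) (u2 / v2)) =
      ennreal (p n) * (\<integral>\<^sup>+ (l1, l2, l3). ennreal (exp (- l1 * (v1 + 1 / v1) - l2 * (v2 + 1 / v2)
        - l3 * (v1 / v2 + v2 / v1))) \<partial>N n))"
    using gamma_combination_law_representation[OF law u] by metis
  then obtain p N where p: "\<And>n. 0 \<le> p n \<and> p n \<le> (1::real)"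
    and N: "\<And>n. prob_space (N n)" "\<And>n. sets (N n) = sets borel"
      "\<And>n. AE (l1, l2, l3) in N n. 0 \<le> l1 \<and> 0 \<le> l2 \<and> 0 \<le> l3"
    and rep: "\<And>n v1 v2. 0 < v1 \<Longrightarrow> 0 < v2 \<Longrightarrow>
      ennreal (laplace_transform (\<mu>s n) (u1 * v1) (u2 * v2) * laplace_transform (\<mu>s n) (u1 / v1) (u2 / v2)) =
      ennreal (p n) * (\<integral>\<^sup>+ (l1, l2, l3). ennreal (exp (- l1 * (v1 + 1 / v1) - l2 * (v2 + 1 / v2)
        - l3 * (v1 / v2 + v2 / v1))) \<partial>N n)"
    by blast
  \<comment> \<open>Both subsequences are chosen before \<open>v1\<close> and \<open>v2\<close> are
    fixed, so a single measure serves all of them.\<close>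
  have "seq_compact {0..1::real}" by (simp add: compact_imp_seq_compact)
  then obtain P r where P: "P \<in> {0..1}" and r: "strict_mono r" and limp: "(p \<circ> r) \<longlonglongrightarrow> P"
    using p by (elim seq_compactE[of _ p]) auto
  obtain r' \<nu> where r': "strict_mono (r' :: nat \<Rightarrow> nat)" and sets: "sets \<nu> = sets borel"
    and nonneg: "AE (l1, l2, l3) in \<nu>. 0 \<le> l1 \<and> 0 \<le> l2 \<and> 0 \<le> l3"
    and lim: "\<And>w1 w2 w3. 0 < w1 \<Longrightarrow> 0 < w2 \<Longrightarrow> 0 < w3 \<Longrightarrow>
      (\<lambda>k. \<integral>\<^sup>+ (l1, l2, l3). ennreal (exp (- l1 * w1 - l2 * w2 - l3 * w3)) \<partial>N (r (r' k)))
      \<longlonglongrightarrow> (\<integral>\<^sup>+ (l1, l2, l3). ennreal (exp (- l1 * w1 - l2 * w2 - l3 * w3)) \<partial>\<nu>)"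
    using octant_laplace_selection[of "\<lambda>k. N (r k)"] N by metis
  let ?\<nu> = "density \<nu> (\<lambda>_. ennreal P)"
  have "(\<lambda>(l1, l2, l3). ennreal (exp (- l1 * w1 - l2 * w2 - l3 * w3))) \<in> borel_measurable \<nu>" for w1 w2 w3 :: real
  proof -
    have [measurable_cong]: "sets \<nu> = sets (borel \<Otimes>\<^sub>M (borel \<Otimes>\<^sub>M borel))"
      using sets unfolding borel_prod .
    show ?thesis by measurable
  qed
  then have scale: "(\<integral>\<^sup>+ (l1, l2, l3). ennreal (exp (- l1 * w1 - l2 * w2 - l3 * w3)) \<partial>?\<nu>) =
      ennreal P * (\<integral>\<^sup>+ (l1, l2, l3). ennreal (exp (- l1 * w1 - l2 * w2 - l3 * w3)) \<partial>\<nu>)" for w1 w2 w3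
    by (simp add: nn_integral_density nn_integral_cmult)
  show "\<exists>\<nu> :: (real \<times> real \<times> real) measure. sets \<nu> = sets borel \<and>
      (AE (l1, l2, l3) in \<nu>. 0 \<le> l1 \<and> 0 \<le> l2 \<and> 0 \<le> l3) \<and>
      (\<forall>v1>0. \<forall>v2>0.
        ennreal (laplace_transform \<mu> (u1 * v1) (u2 * v2) * laplace_transform \<mu> (u1 / v1) (u2 / v2)) =
        (\<integral>\<^sup>+ (l1, l2, l3). ennreal (exp (- l1 * (v1 + 1 / v1) - l2 * (v2 + 1 / v2)
          - l3 * (v1 / v2 + v2 / v1))) \<partial>\<nu>))"
  proof (rule exI[of _ ?\<nu>], intro conjI allI impI)
    show "sets ?\<nu> = sets borel" using sets by simp
    show "AE (l1, l2, l3) in ?\<nu>. 0 \<le> l1 \<and> 0 \<le> l2 \<and> 0 \<le> l3"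
      using nonneg by (subst AE_density) auto
    fix v1 v2 :: real assume v: "0 < v1" "0 < v2"
    let ?I = "\<lambda>D :: (real \<times> real \<times> real) measure. \<integral>\<^sup>+ (l1, l2, l3). ennreal (exp (- l1 * (v1 + 1 / v1)
      - l2 * (v2 + 1 / v2) - l3 * (v1 / v2 + v2 / v1))) \<partial>D"
    let ?f = "\<lambda>D. laplace_transform D (u1 * v1) (u2 * v2) * laplace_transform D (u1 / v1) (u2 / v2)"
    note qs = gamma_combination_law_quadrant[OF law]
    have "(\<lambda>n. ?f (\<mu>s n)) \<longlonglongrightarrow> ?f \<mu>"
      using u v by (intro tendsto_mult laplace_transform_converges[OF conv qs q]) auto
    from LIMSEQ_subseq_LIMSEQ[OF tendsto_ennrealI[OF this] strict_mono_o[OF r r']]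
    have "(\<lambda>k. ennreal (p (r (r' k))) * ?I (N (r (r' k)))) \<longlonglongrightarrow> ennreal (?f \<mu>)"
      using rep[OF v] by (simp add: o_def)
    moreover have "(\<lambda>k. ennreal (p (r (r' k))) * ?I (N (r (r' k)))) \<longlonglongrightarrow> ennreal P * ?I \<nu>"
    proof (rule tendsto_mult_ennreal)
      show "(\<lambda>k. ennreal (p (r (r' k)))) \<longlonglongrightarrow> ennreal P"
        using LIMSEQ_subseq_LIMSEQ[OF limp r'] by (intro tendsto_ennrealI) (simp add: o_def)
      have w: "0 < v1 + 1 / v1" "0 < v2 + 1 / v2" "0 < v1 / v2 + v2 / v1"
        using v by (simp_all add: add_pos_pos)
      show limI: "(\<lambda>k. ?I (N (r (r' k)))) \<longlonglongrightarrow> ?I \<nu>"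
        by (rule lim[OF w])
      \<comment> \<open>Multiplication in \<open>ennreal\<close> is not continuous at 0 times
        infinity. The bound 1 for probability laws on the octant passes to the limit and excludes
        this case.\<close>
      have "?I (N n) \<le> 1" for n
      proof -
        have "?I (N n) \<le> (\<integral>\<^sup>+ l. 1 \<partial>N n)"
          using N(3)[of n]
        proof (intro nn_integral_mono_AE, eventually_elim)
          case (elim l)
          obtain l1 l2 l3 where l: "l = (l1, l2, l3)" by (cases l)
          have "0 \<le> l1 * (v1 + 1 / v1)" "0 \<le> l2 * (v2 + 1 / v2)" "0 \<le> l3 * (v1 / v2 + v2 / v1)"
            using elim w l by (simp_all del: times_divide_eq_right)
          then show ?case by (simp add: l)
        qed
        then show ?thesis by (simp add: prob_space.emeasure_space_1[OF N(1)])
      qed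
      then have "?I \<nu> \<le> 1" by (intro LIMSEQ_le_const2[OF limI]) auto
      then have "?I \<nu> \<noteq> \<top>" by (auto simp: top_unique)
      then show "\<not> (ennreal P = 0 \<and> ?I \<nu> = \<infinity> \<or> ennreal P = \<infinity> \<and> ?I \<nu> = 0)" by simp
    qed
    ultimately show "ennreal (?f \<mu>) = ?I ?\<nu>"
      unfolding scale by (rule LIMSEQ_unique)
  qed
qed

theorem theorem2:
  fixes M :: "'a measure" and X :: "'a \<Rightarrow> real \<times> real"
  assumes "prob_space M"
    and "X \<in> borel_measurable M"
    and "\<And>\<omega>. \<omega> \<in> space M \<Longrightarrow> 0 \<le> fst (X \<omega>) \<and> 0 \<le> snd (X \<omega>)"
    and "BVGGC_strong (distr M borel X)"
  shows "BVGGC_L (distr M borel X) \<and>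
    BVHCM (\<lambda>s1 s2. prob_space.expectation M (\<lambda>\<omega>. exp (- s1 * fst (X \<omega>) - s2 * snd (X \<omega>))))"
proof -
  have hcm: "BVHCM (laplace_transform (distr M borel X))"
    using assms(4) by (rule BVGGC_strong_imp_BVHCM_laplace)
  \<comment> \<open>Change of variables identifies the transform of the law with the expectation on
    the sample space.\<close>
  have "laplace_transform (distr M borel X) =
      (\<lambda>s1 s2. \<integral>\<omega>. exp (- s1 * fst (X \<omega>) - s2 * snd (X \<omega>)) \<partial>M)"
    unfolding laplace_transform_def
    by (intro ext integral_distr[OF assms(2)]) (simp add: borel_prod[symmetric])
  with hcm show ?thesis
    using assms(4) by (simp add: BVGGC_L_def BVGGC_strong_def)
qed

end
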